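(* Let $\ell$ be an integer and let $C$ be an $(n-1+\ell)$-separable necklace with $n$ colors. If $n\ge 6\ell+2$, then (i) there exist two neighboring colors that are both intervals, or (ii) there exists a color consisting of exactly two components.
   Context: A necklace is a set $C$ of pairwise disjoint finite nonempty subsets of $\mathbb{R}$ (called colors). Its string is obtained by listing all points of $\bigcup_{c\in C}c$ in increasing order, replacing each point by its color, and merging consecutive equal letters into one. The number of components of a color is the number of its occurrences in this string; a color is an interval if it has exactly one component. Two colors are neighboring if they appear as consecutive letters in the string. A necklace $C$ is $k$-separable if for every $A\subseteq C$ there exist real numbers $s_1<\dots<s_k$ such that, labelling the intervals $(-\infty,s_1],[s_1,s_2],\dots,[s_{k-1},s_k],[s_k,\infty)$ alternately $A,\bar A,A,\dots$, every interval labelled $A$ is disjoint from $\bigcup_{c\in C\setminus A}c$ and every interval labelled $\bar A$ is disjoint from $\bigcup_{c\in A}c$. *)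

theory Defs
  imports Complex_Main
begin

definition necklace :: "real set set \<Rightarrow> bool" where
  "necklace C \<longleftrightarrow> pairwise disjnt C \<and> (\<forall>c\<in>C. finite c \<and> c \<noteq> {})"

definition color_of :: "real set set \<Rightarrow> real \<Rightarrow> real set" where
  "color_of C x = (THE c. c \<in> C \<and> x \<in> c)"

(* Meaningful for finite C only: otherwise the union is infinite and sorted_list_of_set
   returns the empty list. *)
definition necklace_string :: "real set set \<Rightarrow> real set list" where
  "necklace_string C = remdups_adj (map (color_of C) (sorted_list_of_set (\<Union>C)))"

definition num_components :: "real set set \<Rightarrow> real set \<Rightarrow> nat" where
  "num_components C c = count_list (necklace_string C) c"

definition interval_color :: "real set set \<Rightarrow> real set \<Rightarrow> bool" where
  "interval_color C c \<longleftrightarrow> num_components C c = 1"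

definition neighboring :: "real set set \<Rightarrow> real set \<Rightarrow> real set \<Rightarrow> bool" where
  "neighboring C c d \<longleftrightarrow>
     (\<exists>i. Suc i < length (necklace_string C) \<and>
          {necklace_string C ! i, necklace_string C ! Suc i} = {c, d})"

(* The intervals cut out by separators s 1 < ... < s k, numbered i = 0..k from left to right;
   the bound that does not exist is dropped for i = 0 and for i = k, so that k = 0 leaves the
   whole line as the only interval. *)
definition sep_interval :: "nat \<Rightarrow> (nat \<Rightarrow> real) \<Rightarrow> nat \<Rightarrow> real set" where
  "sep_interval k s i = {x. (0 < i \<longrightarrow> s i \<le> x) \<and> (i < k \<longrightarrow> x \<le> s (Suc i))}"

(* The leftmost interval is labelled A, hence the A-intervals are those with even number. *)
definition separable :: "nat \<Rightarrow> real set set \<Rightarrow> bool" where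
  "separable k C \<longleftrightarrow>
     (\<forall>A\<subseteq>C. \<exists>s :: nat \<Rightarrow> real. strict_mono_on {1..k} s \<and>
        (\<forall>i\<le>k. (even i \<longrightarrow> sep_interval k s i \<inter> \<Union>(C - A) = {}) \<and>
                (odd i \<longrightarrow> sep_interval k s i \<inter> \<Union>A = {})))"

end

theory Submission
  imports Defs
begin

text \<open>
  Read the string as a walk on the colors. Separability with \<^term>\<open>k\<close> points says that every
  set of colors cuts at most \<^term>\<open>k\<close> steps of the walk. Suppose that neither alternative holds, and
  let \<open>a\<close> be the number of intervals; since the other colors occur at least three times, the walk has
  at least \<open>3 n - 2 a - 1\<close> steps. The set of all intervals cuts at least \<open>2 a - 2\<close> steps, because no
  step joins two intervals. Distributing the other colors uniformly at random and then putting every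
  interval opposite its successor in the walk (its predecessor if it comes last) cuts \<open>a\<close> steps for
  sure and every other step with probability at least one half, so that some set cuts at least
  \<open>(3 n - a - 1) / 2\<close> steps. The larger of the two bounds is at least \<open>(6 n - 4) / 5\<close>, which exceeds
  \<open>n - 1 + l\<close> if \<open>6 l + 2 \<le> n\<close>.
\<close>

section \<open>Cut steps and changes of side along a list\<close>

definition cut_steps :: "'a list \<Rightarrow> 'a set \<Rightarrow> nat set" where
  "cut_steps w A = {i. Suc i < length w \<and> (w ! i \<in> A) \<noteq> (w ! Suc i \<in> A)}"

text \<open>\<open>remdups_adj\<close> shifts positions, which a recursive count handles by
  induction; the set \<open>cut_steps\<close> serves where single steps are compared.\<close>

fun changes :: "('a \<Rightarrow> bool) \<Rightarrow> 'a list \<Rightarrow> nat" where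
  "changes P (x # y # zs) = (if P x = P y then 0 else 1) + changes P (y # zs)"
| "changes P _ = 0"

lemma finite_cut_steps: "finite (cut_steps w A)"
  by (rule finite_subset[of _ "{..<length w}"]) (auto simp: cut_steps_def)

lemma changes_eq_sum:
  "changes P xs = (\<Sum>i<length xs - 1. if P (xs ! i) = P (xs ! Suc i) then 0 else 1)"
proof (induction P xs rule: changes.induct)
  case (1 P x y zs)
  then show ?case
    by (simp add: sum.lessThan_Suc_shift del: sum.lessThan_Suc)
qed auto

lemma card_cut_steps: "card (cut_steps w A) = changes (\<lambda>c. c \<in> A) w"
proof -
  have "changes (\<lambda>c. c \<in> A) w = (\<Sum>i<length w - 1. if i \<in> cut_steps w A then 1 else 0)"
    unfolding changes_eq_sum by (rule sum.cong) (auto simp: cut_steps_def)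
  also have "\<dots> = card ({..<length w - 1} \<inter> cut_steps w A)"
    by (simp add: sum.If_cases Int_def)
  also have "{..<length w - 1} \<inter> cut_steps w A = cut_steps w A"
    by (auto simp: cut_steps_def)
  finally show ?thesis by simp
qed

lemma changes_remdups_adj: "changes P (remdups_adj xs) = changes P xs"
proof (induction xs rule: remdups_adj.induct)
  case (3 x y xs)
  show ?case
  proof (cases "x = y")
    case False
    obtain zs where "remdups_adj (y # xs) = y # zs"
      using remdups_adj_Cons' by metis
    with 3 False show ?thesis by simp
  qed (use 3 in simp)
qed simp_all

lemma changes_map: "changes P (map f xs) = changes (\<lambda>x. P (f x)) xs"
  by (induction "\<lambda>x. P (f x)" xs rule: changes.induct) auto

text \<open>A change of \<open>P\<close> changes the parity of \<open>f\<close> and so raises the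
  nondecreasing \<open>f\<close> by at least one. The summand \<open>f x\<close> carries the
  induction.\<close>

lemma changes_le_level:
  fixes f :: "'a \<Rightarrow> nat"
  assumes "sorted (map f (x # xs))" and "\<forall>y\<in>set (x # xs). f y \<le> k \<and> P y = even (f y)"
  shows "changes P (x # xs) + f x \<le> k"
  using assms
proof (induction xs arbitrary: x)
  case (Cons y ys)
  have "changes P (y # ys) + f y \<le> k"
    using Cons by simp
  moreover have "f x \<le> f y" "P x \<noteq> P y \<Longrightarrow> f x \<noteq> f y"
    using Cons.prems by auto
  ultimately show ?case by auto
qed simp

section \<open>Separating points bound the number of cut steps\<close>

lemma ex_sep_interval: "\<exists>i\<le>k. x \<in> sep_interval k s i"
proof -
  define i where "i = (GREATEST i. i \<le> k \<and> (0 < i \<longrightarrow> s i \<le> x))"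
  let ?Q = "\<lambda>i. i \<le> k \<and> (0 < i \<longrightarrow> s i \<le> x)"
  have "?Q i"
    unfolding i_def by (rule GreatestI_nat[of ?Q 0 k]) auto
  moreover have "x \<le> s (Suc i)" if "i < k"
  proof (rule ccontr)
    assume "\<not> x \<le> s (Suc i)"
    with that have "?Q (Suc i)" by auto
    then have "Suc i \<le> i"
      unfolding i_def by (intro Greatest_le_nat[of ?Q _ k]) auto
    then show False by simp
  qed
  ultimately show ?thesis
    by (auto simp: sep_interval_def)
qed

lemma sep_interval_mono:
  assumes "strict_mono_on {1..k} s" "x < y" "i \<le> k"
    and "x \<in> sep_interval k s i" "y \<in> sep_interval k s j"
  shows "i \<le> j"
proof (rule ccontr)
  assume "\<not> i \<le> j"
  then have "s i \<le> x" "y \<le> s (Suc j)"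
    using assms by (auto simp: sep_interval_def)
  moreover have "s (Suc j) \<le> s i"
    by (rule strict_mono_on_leD[OF assms(1)]) (use \<open>\<not> i \<le> j\<close> assms(3) in auto)
  ultimately show False
    using assms(2) by simp
qed

lemma color_of_eq:
  assumes "necklace C" "c \<in> C" "x \<in> c"
  shows "color_of C x = c"
  using assms unfolding color_of_def necklace_def pairwise_def disjnt_def
  by (intro the_equality) auto

lemma set_necklace_string:
  assumes "necklace C" "finite C"
  shows "set (necklace_string C) = C"
proof -
  have "finite (\<Union>C)"
    using assms by (auto simp: necklace_def)
  moreover have "color_of C ` \<Union>C = C"
  proof
    show "color_of C ` \<Union>C \<subseteq> C"
      using color_of_eq[OF assms(1)] by auto
    show "C \<subseteq> color_of C ` \<Union>C"
    proof
      fix c assume c: "c \<in> C"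
      then obtain x where x: "x \<in> c"
        using assms(1) by (auto simp: necklace_def)
      then have "c = color_of C x"
        using color_of_eq[OF assms(1) c] by simp
      with c x show "c \<in> color_of C ` \<Union>C" by blast
    qed
  qed
  ultimately show ?thesis
    by (simp add: necklace_string_def)
qed

text \<open>Number each point by an interval that contains it. The numbers do not decrease along the
  line, stay at most \<open>k\<close>, and their parity tells whether the color of the point lies in
  \<open>A\<close>.\<close>

lemma separable_imp_cut_le:
  assumes "necklace C" "finite C" "separable k C" "A \<subseteq> C"
  shows "card (cut_steps (necklace_string C) A) \<le> k"
proof -
  obtain s :: "nat \<Rightarrow> real" where s: "strict_mono_on {1..k} s"
    and ev: "\<And>i. i \<le> k \<Longrightarrow> even i \<Longrightarrow> sep_interval k s i \<inter> \<Union>(C - A) = {}"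
    and od: "\<And>i. i \<le> k \<Longrightarrow> odd i \<Longrightarrow> sep_interval k s i \<inter> \<Union>A = {}"
    using assms(3,4) unfolding separable_def by meson
  \<comment> \<open>A separating point lies in two intervals. Selecting one for each point makes
    \<open>f\<close> a function, which settles the case \<open>x = y\<close> of
    monotonicity.\<close>
  have "\<forall>x. \<exists>i. i \<le> k \<and> x \<in> sep_interval k s i"
    using ex_sep_interval by blast
  from choice[OF this] obtain f
    where f: "\<And>x. f x \<le> k" "\<And>x. x \<in> sep_interval k s (f x)"
    by blast
  define p where "p = sorted_list_of_set (\<Union>C)"
  have fin: "finite (\<Union>C)"
    using assms by (auto simp: necklace_def)
  have f_mono: "f x \<le> f y" if "x \<le> y" for x y
    using sep_interval_mono[OF s] f that by (cases "x = y") (auto simp: order_less_le)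
  have "sorted p"
    by (simp add: p_def)
  then have sorted_f: "sorted (map f p)"
    unfolding sorted_map by (rule sorted_wrt_mono_rel[rotated]) (rule f_mono)
  have parity: "(color_of C x \<in> A) = even (f x)" if x: "x \<in> set p" for x
  proof -
    obtain c where c: "c \<in> C" "x \<in> c"
      using x unfolding p_def set_sorted_list_of_set[OF fin] by blast
    then have "color_of C x = c"
      using color_of_eq[OF assms(1)] by simp
    then show ?thesis
      using c ev[OF f(1)[of x]] od[OF f(1)[of x]] f(2)[of x] by auto
  qed
  have "changes (\<lambda>x. color_of C x \<in> A) p \<le> k"
  proof (cases p)
    case (Cons x xs)
    have "changes (\<lambda>x. color_of C x \<in> A) (x # xs) + f x \<le> k"
      using sorted_f parity f(1) unfolding Cons by (intro changes_le_level) auto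
    then show ?thesis by (simp add: Cons)
  qed simp
  then show ?thesis
    by (simp add: card_cut_steps necklace_string_def changes_remdups_adj changes_map p_def)
qed

section \<open>Averaging over subsets\<close>

text \<open>Toggling \<open>u\<close> leaves \<open>v\<close> in place and so exchanges the sets
  that separate \<open>u\<close> from \<open>v\<close> with those that do not.\<close>

lemma two_card_separating_subsets:
  assumes "finite B" "u \<in> B" "u \<noteq> v"
  shows "2 * card {A \<in> Pow B. (u \<in> A) \<noteq> (v \<in> A)} = card (Pow B)"
    and "2 * card {A \<in> Pow B. (u \<in> A) = (v \<in> A)} = card (Pow B)"
proof -
  let ?D = "{A \<in> Pow B. (u \<in> A) \<noteq> (v \<in> A)}" and ?S = "{A \<in> Pow B. (u \<in> A) = (v \<in> A)}"
  let ?t = "\<lambda>A. if u \<in> A then A - {u} else insert u A"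
  have "bij_betw ?t ?D ?S"
    by (rule bij_betw_byWitness[where f' = ?t]) (use assms in \<open>auto split: if_splits\<close>)
  then have "card ?D = card ?S"
    by (rule bij_betw_same_card)
  moreover have "card (Pow B) = card ?D + card ?S"
    using assms(1) by (subst card_Un_disjoint[symmetric]) (auto intro!: arg_cong[where f = card])
  ultimately show "2 * card ?D = card (Pow B)" "2 * card ?S = card (Pow B)"
    by simp_all
qed

text \<open>Double counting of the pairs \<open>(j, A)\<close> with \<open>Q j A\<close>: some
  \<open>A\<close> reaches the average.\<close>

lemma ex_at_least_half:
  assumes "finite J" "finite X" "X \<noteq> {}"
    and "\<And>j. j \<in> J \<Longrightarrow> card X \<le> 2 * card {A \<in> X. Q j A}"
  shows "\<exists>A\<in>X. card J \<le> 2 * card {j \<in> J. Q j A}"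
proof (rule ccontr)
  assume "\<not> ?thesis"
  then have "(\<Sum>A\<in>X. 2 * card {j \<in> J. Q j A}) < (\<Sum>A\<in>X. card J)"
    using assms(2,3) by (intro sum_strict_mono) auto
  also have "\<dots> = (\<Sum>j\<in>J. card X)"
    by simp
  also have "\<dots> \<le> (\<Sum>j\<in>J. 2 * card {A \<in> X. Q j A})"
    using assms(4) by (rule sum_mono)
  also have "\<dots> = 2 * (\<Sum>j\<in>J. card {A \<in> X. Q j A})"
    by (simp add: sum_distrib_left)
  also have "(\<Sum>j\<in>J. card {A \<in> X. Q j A}) = (\<Sum>A\<in>X. card {j \<in> J. Q j A})"
    using sum_multicount_gen[OF assms(1,2), of "\<lambda>j A. Q j A"] assms(1,2) by simp
  also have "2 * \<dots> = (\<Sum>A\<in>X. 2 * card {j \<in> J. Q j A})"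
    by (simp add: sum_distrib_left)
  finally show False by simp
qed

section \<open>Walks in which letters that occur once are never adjacent\<close>

lemma count_list_eq_1_nth_inject:
  assumes "count_list w (w ! i) = 1" "i < length w" "j < length w" "w ! i = w ! j"
  shows "i = j"
proof -
  have "card {r. r < length w \<and> w ! i = w ! r} = 1"
    using assms(1) by (simp add: count_list_eq_length_filter length_filter_conv_card)
  then obtain r where r: "{r. r < length w \<and> w ! i = w ! r} = {r}"
    by (rule card_1_singletonE)
  have "i \<in> {r. r < length w \<and> w ! i = w ! r}" "j \<in> {r. r < length w \<and> w ! i = w ! r}"
    using assms by simp_all
  then show ?thesis unfolding r by simp
qed

text \<open>\<open>I\<close> stands for the interval colors, and \<open>I_indep\<close> is the
  failure of alternative (i); its contrapositive covers the predecessor.\<close>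

locale sparse_walk =
  fixes w :: "'a list" and I :: "'a set"
  assumes distinct_adj: "distinct_adj w"
    and I_iff: "c \<in> I \<longleftrightarrow> count_list w c = 1"
    and I_indep: "Suc i < length w \<Longrightarrow> w ! i \<in> I \<Longrightarrow> w ! Suc i \<notin> I"
begin

definition I_pos :: "nat set" where
  "I_pos = {i. i < length w \<and> w ! i \<in> I}"

lemma finite_I_pos: "finite I_pos"
  by (simp add: I_pos_def)

lemma nth_I_inject: "w ! i \<in> I \<Longrightarrow> i < length w \<Longrightarrow> j < length w \<Longrightarrow> w ! i = w ! j \<Longrightarrow> i = j"
  using count_list_eq_1_nth_inject I_iff by metis

lemma card_I_pos: "card I_pos = card I"
proof -
  have "bij_betw (\<lambda>i. w ! i) I_pos I"
    unfolding bij_betw_def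
  proof
    show "inj_on (\<lambda>i. w ! i) I_pos"
      by (auto simp: inj_on_def I_pos_def nth_I_inject)
    have "c \<in> set w" if "c \<in> I" for c
      using that I_iff count_list_0_iff[of w c] by force
    then show "(\<lambda>i. w ! i) ` I_pos = I"
      by (fastforce simp: I_pos_def in_set_conv_nth)
  qed
  then show ?thesis
    by (rule bij_betw_same_card)
qed

text \<open>Each occurrence of a letter of \<open>I\<close> cuts the steps on both of its sides, and
  these are distinct. Only the two ends of the walk can lack a step, whence the 2.\<close>

lemma card_cut_I: "2 * card I \<le> card (cut_steps w I) + 2"
proof -
  \<comment> \<open>Step \<open>i\<close> joins positions \<open>i\<close> and \<open>i + 1\<close>:
    \<open>?R\<close> are the steps that leave \<open>I_pos\<close>, \<open>?L\<close> those that
    enter it.\<close>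
  let ?R = "I_pos - {length w - 1}" and ?L = "(\<lambda>i. i - 1) ` (I_pos - {0})"
  have "?R \<inter> ?L = {}"
  proof -
    have "i - 1 \<notin> I_pos" if "i \<in> I_pos - {0}" for i
      using that I_indep[of "i - 1"] by (auto simp: I_pos_def)
    then show ?thesis by blast
  qed
  then have "card (?R \<union> ?L) = card ?R + card ?L"
    using finite_I_pos by (intro card_Un_disjoint) auto
  moreover have "card ?L = card (I_pos - {0})"
    by (rule card_image) (auto simp: inj_on_def)
  moreover have "?R \<union> ?L \<subseteq> cut_steps w I"
  proof -
    have "i - 1 \<in> cut_steps w I" if "i \<in> I_pos - {0}" for i
      using that I_indep[of "i - 1"] by (auto simp: cut_steps_def I_pos_def)
    moreover have "i \<in> cut_steps w I" if "i \<in> ?R" for i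
    proof -
      have "Suc i < length w" "w ! i \<in> I"
        using that by (auto simp: I_pos_def)
      then show ?thesis
        using I_indep by (simp add: cut_steps_def)
    qed
    ultimately show ?thesis by blast
  qed
  then have "card (?R \<union> ?L) \<le> card (cut_steps w I)"
    using finite_cut_steps by (rule card_mono[rotated])
  moreover have "card I \<le> card ?R + 1" "card I \<le> card (I_pos - {0}) + 1"
    using finite_I_pos by (auto simp: card_I_pos[symmetric] card_Diff_singleton_if)
  ultimately show ?thesis by linarith
qed

definition opp :: "nat \<Rightarrow> 'a" where
  "opp i = (if Suc i < length w then w ! Suc i else w ! (i - 1))"

text \<open>\<open>A\<close> decides only the letters outside \<open>I\<close>; the side of a letter
  of \<open>I\<close> is then forced by its neighbor \<open>opp i\<close>.\<close>

definition ext :: "'a set \<Rightarrow> 'a set" where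
  "ext A = (A - I) \<union> {w ! i | i. i \<in> I_pos \<and> opp i \<notin> A}"

lemma mem_ext_outside: "c \<notin> I \<Longrightarrow> c \<in> ext A \<longleftrightarrow> c \<in> A"
  by (auto simp: ext_def I_pos_def)

text \<open>A letter of \<open>I\<close> has a single position, so no other position can put it into
  \<open>ext A\<close>.\<close>

lemma mem_ext_I_pos:
  assumes "i \<in> I_pos"
  shows "w ! i \<in> ext A \<longleftrightarrow> opp i \<notin> A"
proof -
  have "j = i" if "j \<in> I_pos" "w ! j = w ! i" for j
    using that assms nth_I_inject by (simp add: I_pos_def)
  with assms show ?thesis
    by (auto simp: ext_def I_pos_def)
qed

lemma ex_large_cut:
  assumes len: "2 \<le> length w"
  shows "\<exists>A \<subseteq> set w. length w - 1 + card I \<le> 2 * card (cut_steps w A)"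
proof -
  \<comment> \<open>\<open>S\<close> holds the step from each interval to its \<open>opp\<close>,
    cut for every \<open>A\<close>; \<open>J\<close> holds the rest, to be cut half of the time.
    Twice the expected number of cuts is then at least
    \<open>2 * card S + card J = length w - 1 + card I\<close>.\<close>
  define S where "S = (\<lambda>i. if Suc i < length w then i else i - 1) ` I_pos"
  define J where "J = {..<length w - 1} - S"
  define B where "B = set w - I"
  have S_sub: "S \<subseteq> {..<length w - 1}"
    using len by (auto simp: S_def I_pos_def)
  have "inj_on (\<lambda>i. if Suc i < length w then i else i - 1) I_pos"
  proof (rule inj_onI)
    fix i j
    assume *: "i \<in> I_pos" "j \<in> I_pos"
      "(if Suc i < length w then i else i - 1) = (if Suc j < length w then j else j - 1)"
    \<comment> \<open>Distinct positions could share a step only if they were consecutive, which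
      \<open>I_indep\<close> forbids.\<close>
    then have "i = j \<or> j = Suc i \<or> i = Suc j"
      using len by (auto simp: I_pos_def split: if_splits)
    then show "i = j"
      using * I_indep[of i] I_indep[of j] by (auto simp: I_pos_def)
  qed
  then have card_S: "card S = card I"
    unfolding S_def card_I_pos[symmetric] by (rule card_image)
  have S_cut: "S \<subseteq> cut_steps w (ext A)" for A
  proof
    fix r assume "r \<in> S"
    then obtain i where i: "i \<in> I_pos" "r = (if Suc i < length w then i else i - 1)"
      by (auto simp: S_def)
    show "r \<in> cut_steps w (ext A)"
    proof (cases "Suc i < length w")
      case True
      then have "w ! Suc i \<notin> I"
        using i I_indep by (simp add: I_pos_def)
      with True i show ?thesis
        by (simp add: cut_steps_def mem_ext_I_pos mem_ext_outside opp_def)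
    next
      case False
      then obtain j where j: "i = Suc j" "i < length w"
        using i len by (cases i) (auto simp: I_pos_def)
      then have "w ! j \<notin> I"
        using i I_indep[of j] by (auto simp: I_pos_def)
      with False i j mem_ext_I_pos[OF i(1)] show ?thesis
        by (simp add: cut_steps_def mem_ext_outside opp_def)
    qed
  qed
  have half: "card (Pow B) \<le> 2 * card {A \<in> Pow B. r \<in> cut_steps w (ext A)}" if "r \<in> J" for r
  proof -
    have r: "Suc r < length w" "r \<notin> S"
      using that by (auto simp: J_def)
    \<comment> \<open>A step that leaves an interval lies in \<open>S\<close>, so a step of
      \<open>J\<close> can only enter one.\<close>
    have rI: "w ! r \<notin> I"
    proof
      assume "w ! r \<in> I"
      then have "r \<in> S"
        using r unfolding S_def I_pos_def by (intro image_eqI[of _ _ r]) auto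
      with r show False by simp
    qed
    then have rB: "w ! r \<in> B"
      using r by (simp add: B_def)
    have finB: "finite B"
      by (simp add: B_def)
    show ?thesis
    proof (cases "w ! Suc r \<in> I")
      case False
      then have "{A \<in> Pow B. r \<in> cut_steps w (ext A)} =
          {A \<in> Pow B. (w ! r \<in> A) \<noteq> (w ! Suc r \<in> A)}"
        using r rI by (simp add: cut_steps_def mem_ext_outside)
      moreover have "w ! r \<noteq> w ! Suc r"
        using distinct_adj r by (simp add: distinct_adj_conv_nth)
      ultimately show ?thesis
        using two_card_separating_subsets(1)[OF finB rB] by simp
    next
      case True
      then have pos: "Suc r \<in> I_pos"
        using r by (simp add: I_pos_def)
      \<comment> \<open>If the interval were the last letter, its step to \<open>opp\<close> would
        be \<open>r\<close> itself.\<close>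
      have r2: "Suc (Suc r) < length w"
      proof (rule ccontr)
        assume "\<not> ?thesis"
        then have "r \<in> S"
          using pos unfolding S_def by (intro image_eqI[of _ _ "Suc r"]) auto
        with r show False by simp
      qed
      \<comment> \<open>The interval at \<open>Suc r\<close> is opposite to the letter after it, so
        step \<open>r\<close> is cut iff the letters around the interval are on the same side. If
        they are equal, this is so for every \<open>A\<close>.\<close>
      have "{A \<in> Pow B. r \<in> cut_steps w (ext A)} =
          {A \<in> Pow B. (w ! r \<in> A) = (w ! Suc (Suc r) \<in> A)}"
        using r r2 rI by (auto simp: cut_steps_def mem_ext_outside mem_ext_I_pos[OF pos] opp_def)
      then show ?thesis
        using two_card_separating_subsets(2)[OF finB rB, of "w ! Suc (Suc r)"]
        by (cases "w ! r = w ! Suc (Suc r)") (simp_all add: Pow_def)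
    qed
  qed
  obtain A where A: "A \<in> Pow B" "card J \<le> 2 * card {r \<in> J. r \<in> cut_steps w (ext A)}"
    using ex_at_least_half[of J "Pow B" "\<lambda>r A. r \<in> cut_steps w (ext A)"] half
    by (auto simp: J_def B_def)
  have "ext A \<subseteq> set w"
    using A(1) by (auto simp: ext_def B_def I_pos_def)
  moreover have "length w - 1 + card I \<le> 2 * card (cut_steps w (ext A))"
  proof -
    have "card J = length w - 1 - card I" "card I \<le> length w - 1"
      using S_sub card_S card_mono[OF _ S_sub] by (simp_all add: J_def card_Diff_subset finite_subset)
    moreover have "card S + card {r \<in> J. r \<in> cut_steps w (ext A)} =
        card (S \<union> {r \<in> J. r \<in> cut_steps w (ext A)})"
      using S_sub by (intro card_Un_disjoint[symmetric]) (auto simp: J_def finite_subset)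
    moreover have "\<dots> \<le> card (cut_steps w (ext A))"
      using S_cut finite_cut_steps by (intro card_mono) auto
    ultimately show ?thesis
      using A(2) card_S by linarith
  qed
  ultimately show ?thesis by blast
qed

end

section \<open>Contradiction between the cut bounds\<close>

theorem theorem18:
  fixes l :: int and n k :: nat and C :: "real set set"
  assumes "necklace C" and "finite C" and "card C = n"
    and "int k = int n - 1 + l" and "separable k C"
    and "int n \<ge> 6 * l + 2"
  shows "(\<exists>c\<in>C. \<exists>d\<in>C. neighboring C c d \<and> interval_color C c \<and> interval_color C d) \<or>
         (\<exists>c\<in>C. num_components C c = 2)"
proof (rule ccontr)
  assume neg: "\<not> ?thesis"
  define w where "w = necklace_string C"
  define I where "I = {c. count_list w c = 1}"
  have no_adjacent: "count_list w d \<noteq> 1"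
    if "c \<in> C" "d \<in> C" "neighboring C c d" "count_list w c = 1" for c d
    using neg that unfolding interval_color_def num_components_def w_def by blast
  have no_two: "count_list w c \<noteq> 2" if "c \<in> C" for c
    using neg that unfolding num_components_def w_def by blast
  have set_w: "set w = C"
    using set_necklace_string assms(1,2) by (simp add: w_def)
  have I_sub: "I \<subseteq> C"
    using set_w count_list_0_iff[of w] by (force simp: I_def)
  interpret sparse_walk w I
  proof
    show "distinct_adj w"
      by (simp add: w_def necklace_string_def distinct_adj_remdups_adj)
  next
    fix i assume i: "Suc i < length w" "w ! i \<in> I"
    then have "neighboring C (w ! i) (w ! Suc i)"
      by (auto simp: neighboring_def w_def)
    moreover have "w ! i \<in> C" "w ! Suc i \<in> C"
      using i set_w by (auto simp: set_conv_nth)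
    ultimately show "w ! Suc i \<notin> I"
      using i no_adjacent unfolding I_def by blast
  qed (simp add: I_def)
  have card_I: "card I \<le> n"
    using I_sub assms(2,3) card_mono by blast
  have len: "3 * n \<le> length w + 2 * card I"
  proof -
    have "3 \<le> count_list w c" if "c \<in> C - I" for c
    proof -
      have "count_list w c \<noteq> 0" "count_list w c \<noteq> 1" "count_list w c \<noteq> 2"
        using that no_two[of c] set_w count_list_0_iff[of w c] by (auto simp: I_def)
      then show ?thesis by simp
    qed
    then have "(\<Sum>c\<in>C - I. 3) \<le> (\<Sum>c\<in>C - I. count_list w c)"
      by (rule sum_mono)
    moreover have "(\<Sum>c\<in>I. count_list w c) = card I"
      by (simp add: I_def)
    moreover have "length w = (\<Sum>c\<in>C. count_list w c)"
      using sum_count_set[of w C] set_w assms(2) by simp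
    moreover have "\<dots> = (\<Sum>c\<in>C - I. count_list w c) + (\<Sum>c\<in>I. count_list w c)"
      using sum.subset_diff[OF I_sub assms(2)] .
    moreover have "card (C - I) = n - card I"
      using I_sub assms(2,3) by (simp add: card_Diff_subset finite_subset)
    ultimately show ?thesis
      using card_I by simp
  qed
  have cut_I: "2 * card I \<le> k + 2"
    using card_cut_I separable_imp_cut_le[OF assms(1,2,5) I_sub] by (simp add: w_def)
  show False
  proof (cases "2 \<le> length w")
    case True
    then obtain A where A: "A \<subseteq> C" "length w - 1 + card I \<le> 2 * card (cut_steps w A)"
      using ex_large_cut set_w by auto
    then have "length w - 1 + card I \<le> 2 * k"
      using separable_imp_cut_le[OF assms(1,2,5) A(1)] by (simp add: w_def)
    \<comment> \<open>With \<open>a = card I\<close>, \<open>2 k \<ge> 3 n - a - 1\<close> and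
      \<open>2 a \<le> k + 2\<close> give \<open>5 k \<ge> 6 n - 4\<close>, that is
      \<open>n + 1 \<le> 5 l\<close>. So \<open>l\<close> is positive, against
      \<open>6 l + 2 \<le> n\<close>.\<close>
    then show False
      using True len cut_I assms(4,6) by linarith
  next
    case False
    \<comment> \<open>Now \<open>n \<le> 1\<close>, so \<open>6 l + 2 \<le> n\<close> makes
      \<open>l\<close> negative and hence \<open>n - 1 + l\<close> negative, while \<open>k\<close>
      is a natural number.\<close>
    have "n \<le> length w"
      using set_w assms(3) card_length by blast
    then show False
      using False len cut_I card_I assms(4,6) by linarith
  qed
qed

end
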